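(* Let $F=\{1,2,3,5,8,13,\dots\}$ be the set of Fibonacci numbers, and let $AP_F$ be the set of all arithmetic progressions whose common difference (gap) belongs to $F$. Then $AP_F$ is not $2$-regular. Moreover, $dor(AP_F)=1$.
   Context: $[n]:=\{1,2,\dots,n\}$. For a set $D$ of positive integers, $AP_D$ denotes the set of all arithmetic progressions with common difference in $D$, and $n(AP_D,k;r)$ denotes the smallest positive integer $n$ such that every $r$-coloring of $[n]$ contains a monochromatic $k$-term arithmetic progression whose common difference is in $D$ (if no such $n$ exists, one writes $n(AP_D,k;r)=\infty$). $AP_D$ is $r$-regular if $n(AP_D,k;r)$ exists (is finite) for all positive integers $k$. The degree of regularity $dor(AP_D)$ is the largest $r$ such that $AP_D$ is $r$-regular. *)

theory Defs
  imports "HOL-Number_Theory.Fib" "HOL-Library.Extended_Nat" "HOL-Library.FuncSet"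
begin

(* The k-term members of AP_D, as sets of integers. Throughout, D is meant to be a set of
   positive integers, so that the k terms of a progression are distinct. *)
definition AP :: "nat set \<Rightarrow> nat \<Rightarrow> nat set set" where
  "AP D k = {(\<lambda>i. a + i * d) ` {..<k} | a d. a \<ge> 1 \<and> d \<in> D}"

definition monochromatic :: "(nat \<Rightarrow> nat) \<Rightarrow> nat set \<Rightarrow> bool" where
  "monochromatic c A \<longleftrightarrow> (\<exists>j. \<forall>x\<in>A. c x = j)"

(* Every r-coloring of [n] admits a monochromatic k-term progression inside [n]. Colors are
   1, ..., r; values of c outside [n] play no role. *)
definition forces_AP :: "nat set \<Rightarrow> nat \<Rightarrow> nat \<Rightarrow> nat \<Rightarrow> bool" where
  "forces_AP D k r n \<longleftrightarrow>
     (\<forall>c \<in> {1..n} \<rightarrow> {1..r}. \<exists>A \<in> AP D k. A \<subseteq> {1..n} \<and> monochromatic c A)"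

(* n(AP_D, k; r). Since Inf {} = \<infinity> in enat and every nonempty set of enat attains its
   infimum, this is the least admissible n, or \<infinity> if there is none. *)
definition n_AP :: "nat set \<Rightarrow> nat \<Rightarrow> nat \<Rightarrow> enat" where
  "n_AP D k r = Inf {enat n | n. n \<ge> 1 \<and> forces_AP D k r n}"

definition r_regular :: "nat set \<Rightarrow> nat \<Rightarrow> bool" where
  "r_regular D r \<longleftrightarrow> (\<forall>k\<ge>1. n_AP D k r \<noteq> \<infinity>)"

(* The largest r \<ge> 1 for which AP_D is r-regular. The supremum in enat is a maximum whenever
   there are finitely many (and at least one) such r, and \<infinity> if there are infinitely many. *)
definition dor :: "nat set \<Rightarrow> enat" where
  "dor D = Sup {enat r | r. r \<ge> 1 \<and> r_regular D r}"

definition Fibs :: "nat set" where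
  "Fibs = {fib m | m. m \<ge> 2}"

end

theory Submission
  imports Defs
begin

text \<open>
  Colour \<open>x\<close> by the half of the circle \<open>\<real>/\<int>\<close> that contains \<open>x/\<surd>5\<close>. A progression with
  difference \<open>d\<close> becomes an orbit of the rotation by \<open>d/\<surd>5\<close>. If the distance \<open>\<delta>\<close> from
  \<open>d/\<surd>5\<close> to the nearest integer satisfies \<open>\<delta> \<ge> c\<close>, then the orbit moves in steps of length at
  least \<open>c\<close> and at most \<open>1/2\<close>, so it cannot jump over a half circle and leaves the one in which it
  starts after at most \<open>\<lceil>1/(2c)\<rceil>\<close> steps. So a bound \<open>c > 0\<close> that serves all Fibonacci numbers
  at once limits the length of all monochromatic progressions.

  The number \<open>1/\<surd>5\<close> has such a bound because of the Lucas numbers. Writing \<open>L\<close> for the Lucas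
  number with the same index as the Fibonacci number \<open>d\<close>, one has \<open>L\<^sup>2 = 5d\<^sup>2 \<plusminus> 4\<close>. Hence
  \<open>d/\<surd>5\<close> is close to \<open>L/5\<close>, while \<open>L\<close> is never divisible by \<open>5\<close>, so \<open>d/\<surd>5\<close> stays away
  from the integers; \<open>c = 1/10\<close> works (\<open>Fibs_rotation\<close>). It follows that no monochromatic
  progression has six terms.

  The colouring has two colours, so it also defeats \<open>r\<close>-regularity for every \<open>r \<ge> 2\<close>. With a
  single colour the progression \<open>1, \<dots>, k\<close> is monochromatic, since \<open>1\<close> is a Fibonacci number.
\<close>

text \<open>
  The number \<open>2 F(n+1) - F(n)\<close> is the \<open>n\<close>-th Lucas number. In terms of \<open>F(n)\<close> and \<open>F(n+1)\<close>
  the claim is Cassini's identity.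
\<close>

lemma Lucas_square_fib:
  "(2 * int (fib (Suc n)) - int (fib n))\<^sup>2 = 5 * (int (fib n))\<^sup>2 + 4 * (-1) ^ n"
proof (induction n)
  case (Suc n)
  then show ?case by (simp add: algebra_simps power2_eq_square)
qed simp

lemma Lucas_companion:
  assumes "d \<in> Fibs"
  obtains L :: int where "L \<ge> 0" "L\<^sup>2 = 5 * (int d)\<^sup>2 + 4 \<or> L\<^sup>2 = 5 * (int d)\<^sup>2 - 4"
proof -
  obtain m where m: "d = fib m" using assms by (auto simp: Fibs_def)
  let ?L = "2 * int (fib (Suc m)) - int (fib m)"
  have "fib m \<le> fib (Suc m)" by (rule fib_mono) simp
  hence "?L \<ge> 0" by linarith
  moreover have "?L\<^sup>2 = 5 * (int d)\<^sup>2 + 4 \<or> ?L\<^sup>2 = 5 * (int d)\<^sup>2 - 4"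
    using Lucas_square_fib[of m] m by (cases "even m") auto
  ultimately show ?thesis by (rule that)
qed

text \<open>
  The two bounds on \<open>t\<close> come from \<open>2d/\<surd>5 = 2L/5 + 2(\<surd>5 d - L)/5\<close>. The first summand is
  congruent modulo \<open>2\<close> to one of \<open>\<plusminus>2/5, \<plusminus>4/5\<close>, and the second is at most \<open>1/5\<close> in
  absolute value as soon as \<open>d \<ge> 2\<close>.
\<close>

lemma Fibs_rotation:
  assumes "d \<in> Fibs"
  obtains N :: int and t :: real
  where "2 * real d / sqrt 5 = 2 * of_int N + t" "1/5 \<le> \<bar>t\<bar>" "\<bar>t\<bar> \<le> 1"
proof (cases "d \<ge> 2")
  case False
  have "0 < d" using assms by (auto simp: Fibs_def intro!: fib_neq_0_nat)
  with False have "d = 1" by simp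
  moreover have "2 \<le> sqrt 5" by (rule real_le_rsqrt) simp
  moreover have "sqrt 5 \<le> 10" by (rule real_le_lsqrt) simp_all
  ultimately show ?thesis by (intro that[of 0 "2 / sqrt 5"]) (auto simp: field_simps)
next
  case True
  obtain L :: int where "L \<ge> 0"
    and L: "L\<^sup>2 = 5 * (int d)\<^sup>2 + 4 \<or> L\<^sup>2 = 5 * (int d)\<^sup>2 - 4"
    by (rule Lucas_companion[OF assms])
  have "\<not> 5 dvd L"
  proof
    assume "5 dvd L"
    hence "5 dvd L\<^sup>2" by (simp add: power2_eq_square)
    with L show False by presburger
  qed
  \<comment> \<open>The representative of \<open>L\<close> modulo \<open>5\<close> of least absolute value is one of \<open>\<plusminus>1, \<plusminus>2\<close>.\<close>
  then obtain N r where Nr: "L = 5 * N + r" "1 \<le> \<bar>r\<bar>" "\<bar>r\<bar> \<le> 2"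
  proof -
    have "L = 5 * ((L + 2) div 5) + ((L + 2) mod 5 - 2)" by presburger
    moreover have "1 \<le> \<bar>(L + 2) mod 5 - 2\<bar>" "\<bar>(L + 2) mod 5 - 2\<bar> \<le> 2"
      using \<open>\<not> 5 dvd L\<close> by presburger+
    ultimately show ?thesis by (rule that)
  qed
  define e where "e = sqrt 5 * real d - of_int L"
  have "(int d)\<^sup>2 \<ge> 2\<^sup>2" using True by (intro power_mono) auto
  hence "L\<^sup>2 \<ge> 4\<^sup>2" using L by auto
  hence "L \<ge> 4" using \<open>L \<ge> 0\<close> by (rule power2_le_imp_le)
  have s5: "2 \<le> sqrt 5" by (rule real_le_rsqrt) simp
  have "sqrt 5 * real d \<ge> 2 * 2" using True s5 by (intro mult_mono) auto
  hence S: "8 \<le> sqrt 5 * real d + of_int L" using \<open>L \<ge> 4\<close> by linarith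
  have "\<bar>e\<bar> * 8 \<le> \<bar>e\<bar> * (sqrt 5 * real d + of_int L)"
    using S by (rule mult_left_mono) simp
  also have "\<dots> = \<bar>e * (sqrt 5 * real d + of_int L)\<bar>"
    using S by (simp add: abs_mult)
  also have "e * (sqrt 5 * real d + of_int L) = of_int (5 * (int d)\<^sup>2 - L\<^sup>2)"
    by (simp add: e_def algebra_simps power2_eq_square)
  also have "\<bar>real_of_int (5 * (int d)\<^sup>2 - L\<^sup>2)\<bar> = of_int \<bar>5 * (int d)\<^sup>2 - L\<^sup>2\<bar>"
    by (simp only: of_int_abs)
  also have "\<bar>5 * (int d)\<^sup>2 - L\<^sup>2\<bar> = 4" using L by linarith
  finally have "\<bar>e\<bar> * 8 \<le> 4" by simp
  hence e: "\<bar>e\<bar> \<le> 1/2" by simp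
  define t where "t = 2/5 * of_int r + 2/5 * e"
  have "2 * real d / sqrt 5 = 2/5 * (sqrt 5 * real d)" by (simp add: field_simps)
  also have "\<dots> = 2 * of_int N + t" by (simp add: t_def e_def Nr algebra_simps)
  finally have "2 * real d / sqrt 5 = 2 * of_int N + t" .
  moreover have "1 \<le> \<bar>real_of_int r\<bar>" "\<bar>real_of_int r\<bar> \<le> 2" using Nr by linarith+
  hence "1/5 \<le> \<bar>t\<bar>" "\<bar>t\<bar> \<le> 1" using e unfolding t_def by linarith+
  ultimately show ?thesis by (rule that)
qed

text \<open>
  Steps of length at most \<open>1\<close> meet every unit interval on their way, so constant parity of the
  floor forces the floor itself to be constant.
\<close>

lemma floor_parity_change_pos:
  fixes y t :: real
  assumes t: "1/5 \<le> t" "t \<le> 1"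
    and par: "\<forall>i<6. even \<lfloor>y + real i * t\<rfloor> = even \<lfloor>y\<rfloor>"
  shows False
proof -
  have "\<lfloor>y + real i * t\<rfloor> = \<lfloor>y\<rfloor>" if "i < 6" for i
    using that
  proof (induction i)
    case (Suc i)
    have "\<lfloor>y + real (Suc i) * t\<rfloor> = \<lfloor>y\<rfloor> \<or> \<lfloor>y + real (Suc i) * t\<rfloor> = \<lfloor>y\<rfloor> + 1"
    proof -
      have "\<lfloor>y + real i * t\<rfloor> = \<lfloor>y\<rfloor>" using Suc by simp
      moreover have "y + real (Suc i) * t = (y + real i * t) + t" by (simp add: algebra_simps)
      ultimately show ?thesis using t by linarith
    qed
    moreover have "even \<lfloor>y + real (Suc i) * t\<rfloor> = even \<lfloor>y\<rfloor>" using par Suc.prems by blast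
    ultimately show ?case by auto
  qed simp
  from this[of 5] t show False by (simp, linarith)
qed

lemma floor_parity_change:
  fixes y t :: real
  assumes t: "1/5 \<le> \<bar>t\<bar>" "\<bar>t\<bar> \<le> 1"
    and par: "\<forall>i<6. even \<lfloor>y + real i * t\<rfloor> = b"
  shows False
proof (cases "t \<ge> 0")
  case True
  have "even \<lfloor>y\<rfloor> = b" using par[rule_format, of 0] by simp
  thus False using floor_parity_change_pos[of t y] t par True by simp
next
  case False
  \<comment> \<open>Traversed backwards, the orbit starts at \<open>y + 5t\<close> and has positive step \<open>-t\<close>.\<close>
  have "even \<lfloor>(y + 5 * t) + real i * (-t)\<rfloor> = b" if "i < 6" for i
  proof -
    have "(y + 5 * t) + real i * (-t) = y + real (5 - i) * t"
      using that by (simp add: of_nat_diff algebra_simps)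
    moreover have "even \<lfloor>y + real (5 - i) * t\<rfloor> = b" by (rule par[rule_format]) simp
    ultimately show ?thesis by (simp only:)
  qed
  moreover from this[of 0] have "even \<lfloor>y + 5 * t\<rfloor> = b" by simp
  ultimately show False
    using floor_parity_change_pos[of "-t" "y + 5 * t"] t False by simp
qed

text \<open>The parity of \<open>\<lfloor>2x/\<surd>5\<rfloor>\<close> tells which half of the circle contains \<open>x/\<surd>5\<close>.\<close>

definition half_circle_coloring :: "nat \<Rightarrow> nat" where
  "half_circle_coloring x = (if even \<lfloor>2 * real x / sqrt 5\<rfloor> then 1 else 2)"

lemma half_circle_coloring_no_AP:
  assumes "A \<in> AP Fibs 6"
  shows "\<not> monochromatic half_circle_coloring A"
proof
  assume "monochromatic half_circle_coloring A"
  then obtain j where j: "\<forall>x\<in>A. half_circle_coloring x = j" by (auto simp: monochromatic_def)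
  obtain a d where A: "A = (\<lambda>i. a + i * d) ` {..<6}" and d: "d \<in> Fibs"
    using assms by (auto simp: AP_def)
  obtain N :: int and t where
    Nt: "2 * real d / sqrt 5 = 2 * of_int N + t" and t: "1/5 \<le> \<bar>t\<bar>" "\<bar>t\<bar> \<le> 1"
    by (rule Fibs_rotation[OF d])
  have "even \<lfloor>2 * real a / sqrt 5 + real i * t\<rfloor> = (j = 1)" if "i < 6" for i
  proof -
    have "2 * real (a + i * d) / sqrt 5 = 2 * real a / sqrt 5 + real i * (2 * real d / sqrt 5)"
      by (simp add: field_simps)
    also have "\<dots> = 2 * real a / sqrt 5 + real i * t + of_int (2 * (int i * N))"
      unfolding Nt by (simp add: algebra_simps)
    finally have "\<lfloor>2 * real (a + i * d) / sqrt 5\<rfloor>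
        = \<lfloor>2 * real a / sqrt 5 + real i * t\<rfloor> + 2 * (int i * N)"
      by (simp only: floor_add_int)
    moreover have "half_circle_coloring (a + i * d) = j" using j A that by blast
    ultimately show ?thesis by (auto simp: half_circle_coloring_def split: if_splits)
  qed
  thus False using floor_parity_change[OF t] by blast
qed

lemma not_r_regular_Fibs:
  assumes "r \<ge> 2"
  shows "\<not> r_regular Fibs r"
proof
  assume "r_regular Fibs r"
  hence "n_AP Fibs 6 r \<noteq> \<infinity>" by (simp add: r_regular_def)
  hence "{enat n | n. n \<ge> 1 \<and> forces_AP Fibs 6 r n} \<noteq> {}"
    unfolding n_AP_def by (metis Inf_empty top_enat_def)
  then obtain n where "forces_AP Fibs 6 r n" by blast
  moreover have "half_circle_coloring \<in> {1..n} \<rightarrow> {1..r}"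
    using assms by (auto simp: half_circle_coloring_def)
  ultimately show False using half_circle_coloring_no_AP by (auto simp: forces_AP_def)
qed

lemma r_regular_one:
  assumes "1 \<in> D"
  shows "r_regular D 1"
  unfolding r_regular_def
proof (intro allI impI)
  fix k :: nat
  assume "k \<ge> 1"
  have interval: "(\<lambda>i. 1 + i * 1) ` {..<k} = {1..k}"
  proof -
    have "Suc ` {..<k} = {1..k}" by (auto simp: image_iff Suc_le_eq gr0_conv_Suc)
    thus ?thesis by simp
  qed
  have "{1..k} \<in> AP D k" unfolding AP_def using assms interval by blast
  moreover have "monochromatic c {1..k}" if "c \<in> {1..k} \<rightarrow> {1..1}" for c
    using that by (auto simp: monochromatic_def Pi_iff)
  ultimately have "forces_AP D k 1 k" by (auto simp: forces_AP_def)
  hence "n_AP D k 1 \<le> enat k"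
    unfolding n_AP_def using \<open>k \<ge> 1\<close> by (intro Inf_lower) auto
  thus "n_AP D k 1 \<noteq> \<infinity>" by (auto dest: enat_ile)
qed

theorem theorem2: "\<not> r_regular Fibs 2 \<and> dor Fibs = 1"
proof
  show "\<not> r_regular Fibs 2" by (rule not_r_regular_Fibs) simp
  have "1 \<in> Fibs" by (auto simp: Fibs_def intro!: exI[of _ 2])
  hence "r_regular Fibs 1" by (rule r_regular_one)
  moreover have "r = 1" if "r \<ge> 1" "r_regular Fibs r" for r
    using that not_r_regular_Fibs[of r] by linarith
  ultimately have "{enat r | r. r \<ge> 1 \<and> r_regular Fibs r} = {1}"
    by (auto simp: one_enat_def)
  thus "dor Fibs = 1" by (simp add: dor_def)
qed

end
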